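(* Let $d$ be a positive integer, let $A\subseteq\mathbb{R}^d$ be a bounded set, and suppose that $\gamma(\partial A)=0$, where $\partial A$ is the topological boundary of $A$. Then $A$ is both distance Kolmogorov and measure Kolmogorov.
   Context: $\lambda$ denotes Lebesgue measure on $\mathbb{R}^d$, $|\cdot|$ the Euclidean norm. A set $P\subseteq\mathbb{R}^d$ is called a polyhedron if its topological boundary $\partial P$ can be covered by finitely many (affine) hyperplanes. A bounded measurable set $A\subseteq\mathbb{R}^d$ is measure Kolmogorov if for every $\varepsilon>0$ there is a 1-Lipschitz map $f:A\to\mathbb{R}^d$ such that $f(A)$ is a polyhedron and $\lambda(f(A))>\lambda(A)-\varepsilon$. A bounded set $A\subseteq\mathbb{R}^d$ is distance Kolmogorov if for every $\varepsilon>0$ there is a 1-Lipschitz map $f:A\to\mathbb{R}^d$ such that $f(A)$ is a polyhedron and $|f(x)-x|\le\varepsilon$ for every $x\in A$. The proximal map of a convex function $f:\mathbb{R}^d\to\mathbb{R}$ is $\operatorname{prox}_f(x)=\arg\min_{y\in\mathbb{R}^d}\left(f(y)+\frac{|x-y|^2}{2}\right)$ (the unique minimizer). A function $f:\mathbb{R}^d\to\mathbb{R}$ is polyhedral if it is the maximum of finitely many affine functions. For a polyhedral function $f$, the generalized strip associated to $f$, denoted $S(f)$, is the set of points $x\in\mathbb{R}^d$ such that $f$ is not differentiable at $\operatorname{prox}_f(x)$. A set $S\subseteq\mathbb{R}^d$ is a generalized strip if $S=S(f)$ for some polyhedral $f$; its width is $w(S)=2\inf\{\operatorname{Lip} f :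 f \text{ polyhedral},\ S=S(f)\}$, where $\operatorname{Lip} f$ is the (best) Lipschitz constant of $f$. The outer measure $\gamma$ on subsets of $\mathbb{R}^d$ is $\gamma(A)=\inf\left\{\sum_{i=1}^\infty w(S_i) : S_1,S_2,\dots \text{ generalized strips with } A\subseteq\bigcup_{i=1}^\infty S_i\right\}$. *)

theory Defs
  imports "HOL-Analysis.Analysis"
begin

text \<open>A weaker notion than the library's \<open>polyhedron\<close> (a finite intersection of half-spaces):
  the set need be neither convex nor closed.\<close>

definition polyhedral_set :: "'a::euclidean_space set \<Rightarrow> bool" where
  "polyhedral_set P \<longleftrightarrow>
    (\<exists>\<H>. finite \<H> \<and> (\<forall>H\<in>\<H>. \<exists>a b. a \<noteq> 0 \<and> H = {x. a \<bullet> x = b}) \<and> frontier P \<subseteq> \<Union>\<H>)"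

definition measure_kolmogorov :: "'a::euclidean_space set \<Rightarrow> bool" where
  "measure_kolmogorov A \<longleftrightarrow> bounded A \<and> A \<in> sets lebesgue \<and>
    (\<forall>\<epsilon>>0. \<exists>f :: 'a \<Rightarrow> 'a. 1-lipschitz_on A f \<and> polyhedral_set (f ` A) \<and>
      measure lebesgue (f ` A) > measure lebesgue A - \<epsilon>)"

definition distance_kolmogorov :: "'a::euclidean_space set \<Rightarrow> bool" where
  "distance_kolmogorov A \<longleftrightarrow> bounded A \<and>
    (\<forall>\<epsilon>>0. \<exists>f :: 'a \<Rightarrow> 'a. 1-lipschitz_on A f \<and> polyhedral_set (f ` A) \<and>
      (\<forall>x\<in>A. norm (f x - x) \<le> \<epsilon>))"

text \<open>Only meaningful for convex \<open>f\<close>, where the minimizer exists and is unique.\<close>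

definition prox :: "('a::euclidean_space \<Rightarrow> real) \<Rightarrow> 'a \<Rightarrow> 'a" where
  "prox f x = arg_min (\<lambda>y. f y + (norm (x - y))\<^sup>2 / 2) (\<lambda>_. True)"

text \<open>A pair \<open>(a, b)\<close> encodes the affine function \<open>x \<mapsto> a \<bullet> x + b\<close>.\<close>

definition polyhedral_fun :: "('a::euclidean_space \<Rightarrow> real) \<Rightarrow> bool" where
  "polyhedral_fun f \<longleftrightarrow>
    (\<exists>F :: ('a \<times> real) set. finite F \<and> F \<noteq> {} \<and> (\<forall>x. f x = Max ((\<lambda>(a, b). a \<bullet> x + b) ` F)))"

definition strip_of :: "('a::euclidean_space \<Rightarrow> real) \<Rightarrow> 'a set" where
  "strip_of f = {x. \<not> f differentiable (at (prox f x))}"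

definition generalized_strip :: "'a::euclidean_space set \<Rightarrow> bool" where
  "generalized_strip S \<longleftrightarrow> (\<exists>f. polyhedral_fun f \<and> S = strip_of f)"

definition Lip :: "('a::euclidean_space \<Rightarrow> real) \<Rightarrow> real" where
  "Lip f = Inf {L. L-lipschitz_on UNIV f}"

definition strip_width :: "'a::euclidean_space set \<Rightarrow> real" where
  "strip_width S = 2 * Inf {Lip f | f. polyhedral_fun f \<and> S = strip_of f}"

text \<open>The conversion to \<open>ennreal\<close> loses nothing, since widths of generalized strips are
  nonnegative.\<close>

definition strip_gamma :: "'a::euclidean_space set \<Rightarrow> ennreal" where
  "strip_gamma A =
    (INF S \<in> {S :: nat \<Rightarrow> 'a set. (\<forall>i. generalized_strip (S i)) \<and> A \<subseteq> (\<Union>i. S i)}.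
      \<Sum>i. ennreal (strip_width (S i)))"

end

theory Submission
  imports Defs
begin

text \<open>The heart of the argument is a version of Bang's plank trick: finitely many generalized strips
  are contained in a single one whose width is at most the sum of their widths. As a strip also lies
  in the interior of its dilate, which is at most twice as wide, compactness of \<open>\<partial>A\<close>
  and \<open>\<gamma>(\<partial>A) = 0\<close> give, for every \<open>\<epsilon> > 0\<close>, a polyhedral \<open>f\<close> with slopes at most
  \<open>\<epsilon>\<close> such that \<open>\<partial>A \<subseteq> S(f)\<close>.

  The proximal map of \<open>f\<close> is 1-Lipschitz and moves points by at most \<open>\<epsilon>\<close>. Over each point of
  differentiability of \<open>f\<close> its inverse is locally a translation, so the boundary of the image of \<open>A\<close>
  consists of points of nondifferentiability, and these lie in finitely many hyperplanes.
  Moreover, the image contains almost every point whose closed \<open>\<epsilon>\<close>-ball lies in \<open>A\<close>. Since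
  the translations map almost all of the ball of radius \<open>R - \<epsilon>\<close> injectively into the ball of
  radius \<open>R\<close> minus \<open>S(f)\<close>, the boundary of \<open>A\<close> is a null set, and the volume lost tends to \<open>0\<close>.\<close>

section \<open>Proximal maps of polyhedral functions\<close>

definition affine_max :: "('a::euclidean_space \<times> real) set \<Rightarrow> 'a \<Rightarrow> real" where
  "affine_max F y = Max ((\<lambda>(a, b). a \<bullet> y + b) ` F)"

text \<open>Pairs with the same slope \<open>a\<close> are not compared, so \<open>F\<close> may contain parallel affine functions.\<close>

definition dominant_slope :: "('a::euclidean_space \<times> real) set \<Rightarrow> 'a \<Rightarrow> 'a \<Rightarrow> bool" where
  "dominant_slope F a y \<longleftrightarrow>
    (\<exists>b. (a, b) \<in> F \<and> (\<forall>(a', b')\<in>F. a' = a \<or> a' \<bullet> y + b' < a \<bullet> y + b))"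

lemma polyhedral_fun_iff:
  "polyhedral_fun f \<longleftrightarrow> (\<exists>F. finite F \<and> F \<noteq> {} \<and> f = affine_max F)"
  unfolding polyhedral_fun_def affine_max_def fun_eq_iff by blast

context
  fixes F :: "('a::euclidean_space \<times> real) set"
  assumes fin: "finite F" and ne: "F \<noteq> {}"
begin

section \<open>Maxima of finitely many affine functions\<close>

lemma affine_max_ge: "(a, b) \<in> F \<Longrightarrow> a \<bullet> y + b \<le> affine_max F y"
  unfolding affine_max_def using fin by (intro Max_ge) (auto intro!: rev_image_eqI)

lemma affine_max_attained:
  obtains a b where "(a, b) \<in> F" "affine_max F y = a \<bullet> y + b"
proof -
  have "affine_max F y \<in> (\<lambda>(a, b). a \<bullet> y + b) ` F"
    unfolding affine_max_def using fin ne by (intro Max_in) auto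
  then show ?thesis using that by auto
qed

lemma affine_max_lipschitz:
  assumes "\<And>a b. (a, b) \<in> F \<Longrightarrow> norm a \<le> L"
  shows "L-lipschitz_on UNIV (affine_max F)"
proof -
  have *: "affine_max F x - affine_max F y \<le> L * norm (x - y)" for x y
  proof -
    obtain a b where ab: "(a, b) \<in> F" "affine_max F x = a \<bullet> x + b"
      by (rule affine_max_attained)
    have "affine_max F x - affine_max F y \<le> a \<bullet> (x - y)"
      using ab affine_max_ge[OF ab(1), of y] by (simp add: inner_diff_right)
    also have "\<dots> \<le> norm a * norm (x - y)" by (rule norm_cauchy_schwarz)
    also have "\<dots> \<le> L * norm (x - y)" using assms[OF ab(1)] by (simp add: mult_right_mono)
    finally show ?thesis .
  qed
  show ?thesis
  proof (rule lipschitz_onI)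
    show "dist (affine_max F x) (affine_max F y) \<le> L * dist x y" for x y
      using *[of x y] *[of y x] by (simp add: dist_norm norm_minus_commute abs_le_iff)
    show "0 \<le> L" using assms ne norm_ge_zero order_trans by (metis ex_in_conv surj_pair)
  qed
qed

lemma slopes_bounded: obtains L where "\<And>a b. (a, b) \<in> F \<Longrightarrow> norm a \<le> L"
proof
  show "norm a \<le> Max ((norm \<circ> fst) ` F)" if "(a, b) \<in> F" for a b
    using that fin by (intro Max_ge) (auto intro!: rev_image_eqI)
qed

lemma continuous_affine_max: "continuous_on UNIV (affine_max F)"
  using affine_max_lipschitz lipschitz_on_continuous_on slopes_bounded by metis

lemma affine_max_convex:
  assumes "0 \<le> t" "t \<le> 1"
  shows "affine_max F ((1 - t) *\<^sub>R p + t *\<^sub>R z) \<le> (1 - t) * affine_max F p + t * affine_max F z"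
proof -
  obtain a b where ab: "(a, b) \<in> F"
      "affine_max F ((1 - t) *\<^sub>R p + t *\<^sub>R z) = a \<bullet> ((1 - t) *\<^sub>R p + t *\<^sub>R z) + b"
    by (rule affine_max_attained)
  have "a \<bullet> ((1 - t) *\<^sub>R p + t *\<^sub>R z) + b = (1 - t) * (a \<bullet> p + b) + t * (a \<bullet> z + b)"
    by (simp add: inner_add_right algebra_simps)
  also have "\<dots> \<le> (1 - t) * affine_max F p + t * affine_max F z"
    using assms affine_max_ge[OF ab(1)] by (intro add_mono mult_left_mono) auto
  finally show ?thesis using ab by simp
qed

text \<open>Among the pairs with slope \<open>a\<close> the largest constant wins wherever
  \<open>a\<close> dominates, so one \<open>c\<close> serves all such points at once.\<close>

lemma dominant_slope_affine:
  assumes "(a, b0) \<in> F"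
  obtains c where "(a, c) \<in> F"
    and "\<And>y. dominant_slope F a y \<Longrightarrow> affine_max F y = a \<bullet> y + c"
proof -
  define B where "B = {b. (a, b) \<in> F}"
  have "B = snd ` (F \<inter> {a} \<times> UNIV)" unfolding B_def by force
  then have fB: "finite B" using fin by simp
  have "B \<noteq> {}" using assms B_def by auto
  have c: "Max B \<in> B" using fB \<open>B \<noteq> {}\<close> by simp
  show ?thesis
  proof
    show cF: "(a, Max B) \<in> F" using c B_def by simp
    fix y assume "dominant_slope F a y"
    then obtain b where b: "(a, b) \<in> F"
        "\<And>a' b'. (a', b') \<in> F \<Longrightarrow> a' = a \<or> a' \<bullet> y + b' < a \<bullet> y + b"
      unfolding dominant_slope_def by fast
    have le: "b' \<le> Max B" if "(a, b') \<in> F" for b' using that fB B_def by simp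
    obtain a1 b1 where a1: "(a1, b1) \<in> F" "affine_max F y = a1 \<bullet> y + b1"
      by (rule affine_max_attained)
    have "a1 \<bullet> y + b1 \<le> a \<bullet> y + Max B"
      using b(2)[OF a1(1)] le[OF b(1)] le a1(1) by fastforce
    then show "affine_max F y = a \<bullet> y + Max B"
      using affine_max_ge[OF cF, of y] a1 by simp
  qed
qed

text \<open>Dominance amounts to finitely many strict inequalities between continuous functions;
  pairs with slope \<open>a\<close> impose no condition and contribute \<open>UNIV\<close> to
  \<open>U\<close>.\<close>

lemma dominant_slope_open:
  assumes "dominant_slope F a y"
  obtains e where "e > 0" "\<And>y'. y' \<in> ball y e \<Longrightarrow> dominant_slope F a y'"
proof -
  obtain b where b: "(a, b) \<in> F"
      "\<And>a' b'. (a', b') \<in> F \<Longrightarrow> a' = a \<or> a' \<bullet> y + b' < a \<bullet> y + b"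
    using assms unfolding dominant_slope_def by fast
  define U where "U = (\<Inter>(a', b')\<in>F. if a' = a then UNIV else {z. a' \<bullet> z + b' < a \<bullet> z + b})"
  have "open (if a' = a then UNIV else {z. a' \<bullet> z + b' < a \<bullet> z + b})" for a' b'
    by (auto intro!: open_Collect_less continuous_intros)
  then have "open U" unfolding U_def using fin by (intro open_INT) auto
  moreover have "y \<in> U" unfolding U_def using b(2) by (auto split: if_splits dest: b(2))
  ultimately obtain e where e: "e > 0" "ball y e \<subseteq> U" using open_contains_ball by blast
  have "dominant_slope F a y'" if "y' \<in> ball y e" for y'
  proof -
    have "y' \<in> U" using that e by blast
    then have "a' = a \<or> a' \<bullet> y' + b' < a \<bullet> y' + b" if "(a', b') \<in> F" for a' b'
      using that unfolding U_def by (fastforce split: if_splits)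
    then show ?thesis unfolding dominant_slope_def using b(1) by auto
  qed
  then show ?thesis using e that by blast
qed

section \<open>Subgradients and differentiability\<close>

lemma dominant_slope_subgradient:
  assumes "dominant_slope F a y"
  shows "affine_max F z \<ge> affine_max F y + a \<bullet> (z - y)"
proof -
  obtain b0 where "(a, b0) \<in> F" using assms unfolding dominant_slope_def by blast
  then obtain c where c: "(a, c) \<in> F"
      "\<And>y. dominant_slope F a y \<Longrightarrow> affine_max F y = a \<bullet> y + c"
    using dominant_slope_affine by blast
  show ?thesis
    using affine_max_ge[OF c(1), of z] c(2)[OF assms] by (simp add: inner_diff_right)
qed

lemma dominant_slope_differentiable:
  assumes "dominant_slope F a y"
  shows "(affine_max F has_derivative (\<lambda>h. a \<bullet> h)) (at y)"
proof -
  obtain b0 where "(a, b0) \<in> F" using assms unfolding dominant_slope_def by blast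
  then obtain c where c: "\<And>y. dominant_slope F a y \<Longrightarrow> affine_max F y = a \<bullet> y + c"
    using dominant_slope_affine by blast
  obtain e where e: "e > 0" "\<And>y'. y' \<in> ball y e \<Longrightarrow> dominant_slope F a y'"
    using dominant_slope_open[OF assms] by blast
  have "((\<lambda>y. a \<bullet> y + c) has_derivative (\<lambda>h. a \<bullet> h)) (at y)"
    by (auto intro!: derivative_eq_intros)
  then show ?thesis
    by (rule has_derivative_transform_within_open[where s="ball y e"]) (use e c in auto)
qed

text \<open>After subtraction of the linear function with slope \<open>v\<close>, the point
  \<open>y\<close> is a global minimum, so the derivative vanishes there.\<close>

lemma subgradient_eq_derivative:
  assumes D: "(affine_max F has_derivative D) (at y)"
    and v: "\<And>z. affine_max F z \<ge> affine_max F y + v \<bullet> (z - y)"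
  shows "D h = v \<bullet> h"
proof -
  have "((\<lambda>z. affine_max F z - v \<bullet> z) has_derivative (\<lambda>h. D h - v \<bullet> h)) (at y)"
    by (intro has_derivative_diff[OF D] derivative_eq_intros refl) auto
  moreover have "affine_max F y - v \<bullet> y \<le> affine_max F z - v \<bullet> z" for z
    using v[of z] by (simp add: inner_diff_right)
  ultimately have "(\<lambda>h. D h - v \<bullet> h) = (\<lambda>h. 0)"
    by (intro differential_zero_maxmin[of y UNIV]) auto
  then show ?thesis by (metis eq_iff_diff_eq_0)
qed

lemma subgradient_unique:
  assumes D: "affine_max F differentiable (at y)"
    and v: "\<And>z. affine_max F z \<ge> affine_max F y + v \<bullet> (z - y)"
    and w: "\<And>z. affine_max F z \<ge> affine_max F y + w \<bullet> (z - y)"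
  shows "v = w"
proof -
  obtain D' where "(affine_max F has_derivative D') (at y)"
    using D unfolding differentiable_def by blast
  then have "v \<bullet> h = w \<bullet> h" for h
    using subgradient_eq_derivative v w by metis
  then show ?thesis using vector_eq_rdot by blast
qed

lemma active_subgradient:
  assumes "(a, b) \<in> F" "affine_max F y = a \<bullet> y + b"
  shows "affine_max F z \<ge> affine_max F y + a \<bullet> (z - y)"
  using affine_max_ge[OF assms(1), of z] assms(2) by (simp add: inner_diff_right)

text \<open>If pieces with different slopes were active at a point of differentiability, both slopes
  would be subgradients there, against uniqueness. Conversely, near a point with a dominant slope
  the function is affine.\<close>

lemma differentiable_iff_dominant_slope:
  "affine_max F differentiable (at y) \<longleftrightarrow> (\<exists>a. dominant_slope F a y)"
proof
  assume D: "affine_max F differentiable (at y)"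
  obtain a b where ab: "(a, b) \<in> F" "affine_max F y = a \<bullet> y + b"
    by (rule affine_max_attained)
  have "a' = a" if "(a', b') \<in> F" "\<not> a' \<bullet> y + b' < a \<bullet> y + b" for a' b'
  proof -
    have "affine_max F y = a' \<bullet> y + b'"
      using affine_max_ge[OF that(1), of y] that ab by simp
    then show ?thesis
      using subgradient_unique[OF D active_subgradient[OF that(1)] active_subgradient[OF ab]] by blast
  qed
  then have "dominant_slope F a y"
    unfolding dominant_slope_def using ab by blast
  then show "\<exists>a. dominant_slope F a y" ..
next
  assume "\<exists>a. dominant_slope F a y"
  then show "affine_max F differentiable (at y)"
    using dominant_slope_differentiable unfolding differentiable_def by blast
qed

text \<open>At a point without dominant slope two pieces with different slopes tie for the maximum,
  and each such pair ties on one hyperplane.\<close>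

lemma nondifferentiable_in_hyperplanes:
  obtains \<H> where "finite \<H>" "\<forall>H\<in>\<H>. \<exists>a b. a \<noteq> 0 \<and> H = {x. a \<bullet> x = b}"
    and "{y. \<not> affine_max F differentiable (at y)} \<subseteq> \<Union>\<H>"
proof
  let ?h = "\<lambda>((a, b), (a', b')). {x. (a - a') \<bullet> x = b' - b}"
  let ?H = "?h ` ({p. fst (fst p) \<noteq> fst (snd p)} \<inter> F \<times> F)"
  show "finite ?H" using fin by simp
  show "\<forall>H\<in>?H. \<exists>a b. a \<noteq> 0 \<and> H = {x. a \<bullet> x = b}"
  proof
    fix H assume "H \<in> ?H"
    then obtain a b a' b' where "a \<noteq> a'" "H = {x. (a - a') \<bullet> x = b' - b}" by auto
    then show "\<exists>a b. a \<noteq> 0 \<and> H = {x. a \<bullet> x = b}" by (metis right_minus_eq)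
  qed
  show "{y. \<not> affine_max F differentiable (at y)} \<subseteq> \<Union>?H"
  proof
    fix y assume "y \<in> {y. \<not> affine_max F differentiable (at y)}"
    then have n: "\<not> dominant_slope F a y" for a
      using differentiable_iff_dominant_slope by blast
    obtain a b where ab: "(a, b) \<in> F" "affine_max F y = a \<bullet> y + b"
      by (rule affine_max_attained)
    obtain a' b' where a': "(a', b') \<in> F" "a' \<noteq> a" "\<not> a' \<bullet> y + b' < a \<bullet> y + b"
      using n[of a] ab(1) unfolding dominant_slope_def by blast
    have "a' \<bullet> y + b' = a \<bullet> y + b"
      using affine_max_ge[OF a'(1), of y] ab a' by simp
    then have "y \<in> ?h ((a, b), (a', b'))"
      by (simp add: inner_diff_left)
    moreover have "((a, b), (a', b')) \<in> {p. fst (fst p) \<noteq> fst (snd p)} \<inter> F \<times> F"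
      using ab a' by simp
    ultimately show "y \<in> \<Union>?H" by blast
  qed
qed

lemma negligible_nondifferentiable: "negligible {y. \<not> affine_max F differentiable (at y)}"
proof -
  obtain \<H> where H: "finite \<H>" "\<forall>H\<in>\<H>. \<exists>a b. a \<noteq> 0 \<and> H = {x::'a. a \<bullet> x = b}"
    "{y. \<not> affine_max F differentiable (at y)} \<subseteq> \<Union>\<H>"
    by (rule nondifferentiable_in_hyperplanes)
  have "negligible (\<Union>\<H>)"
  proof (rule negligible_Union[OF H(1)])
    fix H assume "H \<in> \<H>"
    then obtain a b where "a \<noteq> 0" "H = {x. a \<bullet> x = b}" using H(2) by auto
    then show "negligible H" using negligible_hyperplane[of a b] by simp
  qed
  then show ?thesis using H(3) by (rule negligible_subset)
qed

section \<open>Existence and properties of the proximal map\<close>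

lemma prox_minimizer_exists:
  obtains p where "\<And>y. affine_max F p + (norm (x - p))\<^sup>2 / 2 \<le> affine_max F y + (norm (x - y))\<^sup>2 / 2"
proof -
  let ?h = "\<lambda>y. affine_max F y + (norm (x - y))\<^sup>2 / 2"
  obtain a b where ab: "(a, b) \<in> F" using ne by auto
  define C where "C = ?h x - a \<bullet> x - b"
  have hc: "continuous_on UNIV ?h"
    by (intro continuous_intros continuous_affine_max) simp
  let ?K = "{y. ?h y \<le> ?h x}"
  \<comment> \<open>The quadratic term outgrows the affine minorant given by \<open>(a, b)\<close>.
    Outside this radius \<open>u * (u / 2 - norm a)\<close> exceeds \<open>C\<close>, so the
    sublevel set \<open>?K\<close> is bounded.\<close>
  have "norm (x - y) \<le> 2 * norm a + 2 + 2 * \<bar>C\<bar>" if "?h y \<le> ?h x" for y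
  proof (rule ccontr)
    assume big: "\<not> norm (x - y) \<le> 2 * norm a + 2 + 2 * \<bar>C\<bar>"
    define u where "u = norm (x - y)"
    have "a \<bullet> y + b + u\<^sup>2 / 2 \<le> ?h x"
      using that affine_max_ge[OF ab, of y] u_def by simp
    then have "u\<^sup>2 / 2 - a \<bullet> (x - y) \<le> C" unfolding C_def by (simp add: inner_diff_right)
    moreover have "a \<bullet> (x - y) \<le> norm a * u" unfolding u_def by (rule norm_cauchy_schwarz)
    ultimately have "u * (u / 2 - norm a) \<le> C" by (simp add: algebra_simps power2_eq_square)
    moreover have "1 * (1 + \<bar>C\<bar>) \<le> u * (u / 2 - norm a)"
      using big norm_ge_zero[of a] abs_ge_zero[of C] unfolding u_def[symmetric]
      by (intro mult_mono) linarith+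
    ultimately show False by simp
  qed
  then have "?K \<subseteq> cball x (2 * norm a + 2 + 2 * \<bar>C\<bar>)" by (auto simp: dist_norm)
  then have "bounded ?K" using bounded_cball bounded_subset by blast
  moreover have "closed ?K" using hc by (intro closed_Collect_le) auto
  ultimately have "compact ?K" by (simp add: compact_eq_bounded_closed)
  moreover have "x \<in> ?K" by simp
  moreover have "continuous_on ?K ?h" using hc continuous_on_subset by blast
  ultimately obtain p where p: "p \<in> ?K" "\<forall>y\<in>?K. ?h p \<le> ?h y"
    using continuous_attains_inf[of ?K ?h] by blast
  show ?thesis
  proof
    show "?h p \<le> ?h y" for y using p by (cases "y \<in> ?K") auto
  qed
qed

text \<open>Compare \<open>p\<close> with the points of the segment from \<open>p\<close> to
  \<open>z\<close>, use convexity, divide by \<open>t\<close> and let \<open>t\<close> tend to 0;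
  the quadratic contribution disappears in the limit.\<close>

lemma minimizer_subgradient:
  assumes m: "\<And>y. affine_max F p + (norm (x - p))\<^sup>2 / 2 \<le> affine_max F y + (norm (x - y))\<^sup>2 / 2"
  shows "affine_max F z \<ge> affine_max F p + (x - p) \<bullet> (z - p)"
proof -
  define A where "A = affine_max F z - affine_max F p - (x - p) \<bullet> (z - p)"
  have *: "0 \<le> A + t * (norm (z - p))\<^sup>2 / 2" if t: "0 < t" "t \<le> 1" for t
  proof -
    let ?y = "(1 - t) *\<^sub>R p + t *\<^sub>R z"
    have y: "x - ?y = (x - p) - t *\<^sub>R (z - p)" by (simp add: algebra_simps)
    have "(norm (x - ?y))\<^sup>2 =
        (norm (x - p))\<^sup>2 - 2 * t * ((x - p) \<bullet> (z - p)) + t\<^sup>2 * (norm (z - p))\<^sup>2"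
      unfolding y power2_norm_eq_inner
      by (simp add: inner_diff_left inner_diff_right inner_commute power2_eq_square algebra_simps)
    then have "0 \<le> t * (A + t * (norm (z - p))\<^sup>2 / 2)"
      using m[of ?y] affine_max_convex[of t p z] t unfolding A_def
      by (simp add: algebra_simps power2_eq_square)
    then show ?thesis using t by (simp add: zero_le_mult_iff)
  qed
  have "((\<lambda>t. A + t * (norm (z - p))\<^sup>2 / 2) \<longlongrightarrow> A + 0 * (norm (z - p))\<^sup>2 / 2) (at_right 0)"
    by (intro tendsto_intros) simp
  moreover have "\<forall>\<^sub>F t in at_right 0. 0 \<le> A + t * (norm (z - p))\<^sup>2 / 2"
    using * by (intro eventually_at_rightI[of 0 1]) auto
  ultimately have "0 \<le> A + 0 * (norm (z - p))\<^sup>2 / 2"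
    by (rule tendsto_lowerbound) simp
  then show ?thesis unfolding A_def by simp
qed

text \<open>Subgradients are monotone, so the resolvent is firmly nonexpansive.\<close>

lemma subgradient_nonexpansive:
  assumes "\<And>z. affine_max F z \<ge> affine_max F p + (x - p) \<bullet> (z - p)"
    and "\<And>z. affine_max F z \<ge> affine_max F q + (y - q) \<bullet> (z - q)"
  shows "norm (p - q) \<le> norm (x - y)"
proof -
  have "norm (p - q) * norm (p - q) \<le> (x - y) \<bullet> (p - q)"
    using assms(1)[of q] assms(2)[of p]
    by (simp add: power2_norm_eq_inner power2_eq_square[symmetric] algebra_simps
        inner_diff_left inner_diff_right inner_commute)
  also have "\<dots> \<le> norm (x - y) * norm (p - q)" by (rule norm_cauchy_schwarz)
  finally show ?thesis by (cases "p = q") auto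
qed

lemma prox_subgradient:
  "affine_max F z \<ge> affine_max F (prox (affine_max F) x) +
    (x - prox (affine_max F) x) \<bullet> (z - prox (affine_max F) x)"
proof -
  let ?h = "\<lambda>y. affine_max F y + (norm (x - y))\<^sup>2 / 2"
  obtain p where p: "\<And>y. ?h p \<le> ?h y" using prox_minimizer_exists by blast
  \<comment> \<open>Since a minimizer exists, the point selected by \<open>arg_min\<close> is itself
    a minimizer.\<close>
  then have "is_arg_min ?h (\<lambda>_. True) p" by (simp add: is_arg_min_linorder)
  then have "is_arg_min ?h (\<lambda>_. True) (prox (affine_max F) x)"
    unfolding prox_def arg_min_def by (rule someI)
  then show ?thesis
    by (intro minimizer_subgradient) (auto simp: is_arg_min_linorder)
qed

text \<open>This is nonexpansiveness for two candidates with the same preimage \<open>x\<close>: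
  their distance is at most 0.\<close>

lemma prox_eqI:
  assumes "\<And>z. affine_max F z \<ge> affine_max F p + (x - p) \<bullet> (z - p)"
  shows "prox (affine_max F) x = p"
  using subgradient_nonexpansive[OF prox_subgradient[of x] assms] by simp

lemma prox_lipschitz: "1-lipschitz_on UNIV (prox (affine_max F))"
  using subgradient_nonexpansive[OF prox_subgradient prox_subgradient]
  by (intro lipschitz_onI) (auto simp: dist_norm)

text \<open>The displacement \<open>x - p\<close> is a subgradient at \<open>p\<close>, so its
  squared norm is at most the increase of the function from \<open>p\<close> to \<open>x\<close>,
  which the Lipschitz bound controls.\<close>

lemma prox_dist:
  assumes "\<And>a b. (a, b) \<in> F \<Longrightarrow> norm a \<le> L"
  shows "norm (prox (affine_max F) x - x) \<le> L"
proof -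
  define p where "p = prox (affine_max F) x"
  have lip: "L-lipschitz_on UNIV (affine_max F)"
    using assms by (rule affine_max_lipschitz)
  have "norm (x - p) * norm (x - p) \<le> affine_max F x - affine_max F p"
    using prox_subgradient[of x x] unfolding p_def[symmetric]
    by (simp add: power2_norm_eq_inner power2_eq_square[symmetric])
  also have "\<dots> \<le> L * norm (x - p)"
    using lipschitz_onD[OF lip, of x p] by (simp add: dist_norm)
  finally show ?thesis
    using lipschitz_on_nonneg[OF lip] unfolding p_def[symmetric]
    by (cases "x = p") (auto simp: norm_minus_commute)
qed

text \<open>The preimages of \<open>y\<close> are the points \<open>y + v\<close> with
  \<open>v\<close> a subgradient at \<open>y\<close>, and \<open>a\<close> is the only one. Hence
  the inverse is translation by \<open>a\<close> over the whole region where \<open>a\<close>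
  dominates.\<close>

lemma prox_eq_iff_dominant_slope:
  assumes "dominant_slope F a y"
  shows "prox (affine_max F) x = y \<longleftrightarrow> x = y + a"
proof
  assume "prox (affine_max F) x = y"
  then have "affine_max F z \<ge> affine_max F y + (x - y) \<bullet> (z - y)" for z
    using prox_subgradient[of x z] by simp
  moreover have "affine_max F differentiable (at y)"
    using differentiable_iff_dominant_slope assms by blast
  ultimately have "x - y = a"
    using subgradient_unique dominant_slope_subgradient[OF assms] by blast
  then show "x = y + a" by auto
next
  assume "x = y + a"
  then show "prox (affine_max F) x = y"
    using dominant_slope_subgradient[OF assms] by (intro prox_eqI) simp
qed

text \<open>Off the strip, \<open>x\<close> is \<open>a\<close> plus a point where \<open>a\<close>
  dominates. This form involves no minimization, so strips can be handled through finite families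
  alone.\<close>

lemma not_in_strip_of_iff:
  "x \<notin> strip_of (affine_max F) \<longleftrightarrow> (\<exists>a. dominant_slope F a (x - a))"
proof
  assume "x \<notin> strip_of (affine_max F)"
  then obtain a where a: "dominant_slope F a (prox (affine_max F) x)"
    unfolding strip_of_def using differentiable_iff_dominant_slope by blast
  then have "x = prox (affine_max F) x + a" using prox_eq_iff_dominant_slope by blast
  then show "\<exists>a. dominant_slope F a (x - a)" using a by (metis add_diff_cancel_right')
next
  assume "\<exists>a. dominant_slope F a (x - a)"
  then obtain a where a: "dominant_slope F a (x - a)" ..
  then have "prox (affine_max F) x = x - a" using prox_eq_iff_dominant_slope by simp
  then show "x \<notin> strip_of (affine_max F)"
    unfolding strip_of_def using a differentiable_iff_dominant_slope by auto
qed

end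


section \<open>Covering by a single strip\<close>

text \<open>\<open>bang_strip G\<close> is the generalized strip of \<open>affine_max (bang_lift G)\<close>. In the normalization
  \<open>c = b - |a|\<^sup>2 / 2\<close> of the constants, its definition only involves differences of elements
  of \<open>G\<close>.\<close>

definition bang_strip :: "('a::euclidean_space \<times> real) set \<Rightarrow> 'a set" where
  "bang_strip G = {x. \<forall>a c. (a, c) \<in> G \<longrightarrow>
    (\<exists>a' c'. (a', c') \<in> G \<and> a' \<noteq> a \<and> (a - a') \<bullet> x + c - c' \<le> (norm (a - a'))\<^sup>2 / 2)}"

definition bang_lift :: "('a::euclidean_space \<times> real) set \<Rightarrow> ('a \<times> real) set" where
  "bang_lift G = (\<lambda>(a, c). (a, c + (norm a)\<^sup>2 / 2)) ` G"

lemma dominant_slope_bang_lift: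
  "dominant_slope (bang_lift G) a (x - a) \<longleftrightarrow>
    (\<exists>c. (a, c) \<in> G \<and>
      (\<forall>a' c'. (a', c') \<in> G \<longrightarrow> a' = a \<or> (norm (a - a'))\<^sup>2 / 2 < (a - a') \<bullet> x + c - c'))"
proof -
  \<comment> \<open>Evaluation at \<open>x - a\<close> completes the square: all terms quadratic in
    the slopes combine to half the squared norm of \<open>a - a'\<close>.\<close>
  have *: "a' \<bullet> (x - a) + (c' + (norm a')\<^sup>2 / 2) < a \<bullet> (x - a) + (c + (norm a)\<^sup>2 / 2) \<longleftrightarrow>
      (norm (a - a'))\<^sup>2 / 2 < (a - a') \<bullet> x + c - c'" for a' c c'
  proof -
    have "a \<bullet> (x - a) + (c + (norm a)\<^sup>2 / 2) - (a' \<bullet> (x - a) + (c' + (norm a')\<^sup>2 / 2)) =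
        (a - a') \<bullet> x + c - c' - (norm (a - a'))\<^sup>2 / 2"
      by (simp add: power2_norm_eq_inner inner_diff_left inner_diff_right inner_commute field_simps)
    then show ?thesis by (intro iffI) linarith+
  qed
  have lift: "(a', b) \<in> bang_lift G \<longleftrightarrow> (\<exists>c. (a', c) \<in> G \<and> b = c + (norm a')\<^sup>2 / 2)" for a' b
    unfolding bang_lift_def by auto
  have "dominant_slope (bang_lift G) a (x - a) \<longleftrightarrow>
    (\<exists>c. (a, c) \<in> G \<and> (\<forall>a' c'. (a', c') \<in> G \<longrightarrow> a' = a \<or>
      a' \<bullet> (x - a) + (c' + (norm a')\<^sup>2 / 2) < a \<bullet> (x - a) + (c + (norm a)\<^sup>2 / 2)))"
    unfolding dominant_slope_def Ball_def split_paired_All prod.case lift by blast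
  then show ?thesis unfolding * .
qed

lemma strip_of_bang_lift:
  assumes "finite G" "G \<noteq> {}"
  shows "strip_of (affine_max (bang_lift G)) = bang_strip G"
proof -
  have fin: "finite (bang_lift G)" and ne: "bang_lift G \<noteq> {}"
    using assms unfolding bang_lift_def by auto
  have "x \<notin> strip_of (affine_max (bang_lift G)) \<longleftrightarrow> x \<notin> bang_strip G" for x
    unfolding not_in_strip_of_iff[OF fin ne] dominant_slope_bang_lift bang_strip_def
      mem_Collect_eq not_le[symmetric] by blast
  then show ?thesis by blast
qed

text \<open>The normalization of the constants is invertible, so every generalized strip is a
  \<open>bang_strip\<close>.\<close>

lemma bang_lift_surj: obtains G where "bang_lift G = F"
proof
  show "bang_lift ((\<lambda>(a, b). (a, b - (norm a)\<^sup>2 / 2)) ` F) = F"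
    unfolding bang_lift_def image_image by (auto simp: split_beta)
qed

text \<open>Doubling a family multiplies the left side of the defining inequality by 2 and the right
  side by 4. The points of the original strip therefore satisfy the new inequality strictly, and the
  strict version defines the open set \<open>- K\<close>.\<close>

lemma bang_strip_subset_interior_double:
  assumes "finite G"
  shows "bang_strip G \<subseteq> interior (bang_strip ((\<lambda>(a, c). (2 *\<^sub>R a, 2 * c)) ` G))"
proof -
  define C where "C a c a' c' = {x. (norm (a - a'))\<^sup>2 \<le> (a - a') \<bullet> x + c - c'}"
    for a a' :: 'a and c c' :: real
  define K where "K = (\<Union>p\<in>G. \<Inter>q\<in>{q\<in>G. fst q \<noteq> fst p}. C (fst p) (snd p) (fst q) (snd q))"
  have K_iff: "x \<in> K \<longleftrightarrow> (\<exists>a c. (a, c) \<in> G \<and>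
      (\<forall>a' c'. (a', c') \<in> G \<longrightarrow> a' = a \<or> (norm (a - a'))\<^sup>2 \<le> (a - a') \<bullet> x + c - c'))" for x
    unfolding K_def C_def by (simp add: Bex_def) blast
  have "closed (C a c a' c')" for a c a' c'
    unfolding C_def by (intro closed_Collect_le continuous_intros)
  then have "closed K"
    unfolding K_def using assms by (intro closed_UN closed_INT) auto
  then have "open (- K)" by (rule open_Compl)
  moreover have "- K \<subseteq> bang_strip ((\<lambda>(a, c). (2 *\<^sub>R a, 2 * c)) ` G)"
  proof
    fix x assume "x \<in> - K"
    have double: "(2 *\<^sub>R a - 2 *\<^sub>R a') \<bullet> x + 2 * c - 2 * c' \<le> (norm (2 *\<^sub>R a - 2 *\<^sub>R a'))\<^sup>2 / 2"
      if "\<not> (norm (a - a'))\<^sup>2 \<le> (a - a') \<bullet> x + c - c'" for a a' c c'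
    proof -
      have "2 *\<^sub>R a - 2 *\<^sub>R a' = 2 *\<^sub>R (a - a')" by (simp add: scaleR_diff_right)
      then show ?thesis using that
        by (simp only: inner_scaleR_left norm_scaleR power_mult_distrib) simp
    qed
    show "x \<in> bang_strip ((\<lambda>(a, c). (2 *\<^sub>R a, 2 * c)) ` G)"
      unfolding bang_strip_def
    proof (clarify)
      fix a c assume "(a, c) \<in> G"
      then obtain a' c' where "(a', c') \<in> G" "a' \<noteq> a" "\<not> (norm (a - a'))\<^sup>2 \<le> (a - a') \<bullet> x + c - c'"
        using \<open>x \<in> - K\<close> K_iff by blast
      then show "\<exists>b d. (b, d) \<in> (\<lambda>(a, c). (2 *\<^sub>R a, 2 * c)) ` G \<and> b \<noteq> 2 *\<^sub>R a \<and>
          (2 *\<^sub>R a - b) \<bullet> x + 2 * c - d \<le> (norm (2 *\<^sub>R a - b))\<^sup>2 / 2"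
        using double by (intro exI[of _ "2 *\<^sub>R a'"] exI[of _ "2 * c'"]) force
    qed
  qed
  ultimately have "- K \<subseteq> interior (bang_strip ((\<lambda>(a, c). (2 *\<^sub>R a, 2 * c)) ` G))"
    by (intro interior_maximal)
  moreover have "bang_strip G \<subseteq> - K"
  proof
    fix x assume x: "x \<in> bang_strip G"
    show "x \<in> - K"
    proof
      assume "x \<in> K"
      then obtain a c where a: "(a, c) \<in> G"
          "\<And>a' c'. (a', c') \<in> G \<Longrightarrow> a' = a \<or> (norm (a - a'))\<^sup>2 \<le> (a - a') \<bullet> x + c - c'"
        unfolding K_iff by blast
      obtain a' c' where a': "(a', c') \<in> G" "a' \<noteq> a"
          "(a - a') \<bullet> x + c - c' \<le> (norm (a - a'))\<^sup>2 / 2"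
        using x a(1) unfolding bang_strip_def by blast
      have "0 < (norm (a - a'))\<^sup>2" using a'(2) by simp
      then show False using a(2)[OF a'(1)] a'(2,3) by linarith
    qed
  qed
  ultimately show ?thesis by blast
qed

text \<open>Two elements of the sum that differ in only one summand have the same difference as in that
  summand, so a witness for one strip is a witness for the sum.\<close>

lemma bang_strip_sum:
  "bang_strip G \<union> bang_strip H \<subseteq>
    bang_strip ((\<lambda>((a, c), (a', c')). (a + a', c + c')) ` (G \<times> H))"
    (is "_ \<subseteq> bang_strip ?GH")
proof
  fix x assume x: "x \<in> bang_strip G \<union> bang_strip H"
  have mem: "(a + a', c + c') \<in> ?GH" if "(a, c) \<in> G" "(a', c') \<in> H" for a a' c c'
    using that by force
  show "x \<in> bang_strip ?GH"
    unfolding bang_strip_def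
  proof (clarify)
    fix a1 c1 a2 c2 assume 1: "(a1, c1) \<in> G" and 2: "(a2, c2) \<in> H"
    show "\<exists>a' c'. (a', c') \<in> ?GH \<and> a' \<noteq> a1 + a2 \<and>
        (a1 + a2 - a') \<bullet> x + (c1 + c2) - c' \<le> (norm (a1 + a2 - a'))\<^sup>2 / 2"
      using x
    proof
      assume "x \<in> bang_strip G"
      then obtain a' c' where "(a', c') \<in> G" "a' \<noteq> a1"
          "(a1 - a') \<bullet> x + c1 - c' \<le> (norm (a1 - a'))\<^sup>2 / 2"
        using 1 unfolding bang_strip_def by blast
      then show ?thesis using mem[of a' c' a2 c2] 2
        by (intro exI[of _ "a' + a2"] exI[of _ "c' + c2"]) auto
    next
      assume "x \<in> bang_strip H"
      then obtain a' c' where "(a', c') \<in> H" "a' \<noteq> a2"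
          "(a2 - a') \<bullet> x + c2 - c' \<le> (norm (a2 - a'))\<^sup>2 / 2"
        using 2 unfolding bang_strip_def by blast
      then show ?thesis using mem[of a1 c1 a' c'] 1
        by (intro exI[of _ "a1 + a'"] exI[of _ "c1 + c'"]) auto
    qed
  qed
qed

lemma bang_strip_finite_union:
  assumes "finite I"
    and "\<And>i. i \<in> I \<Longrightarrow> finite (G i) \<and> G i \<noteq> {} \<and> (\<forall>(a, c)\<in>G i. norm a \<le> r i)"
  shows "\<exists>H. finite H \<and> H \<noteq> {} \<and> (\<forall>(a, c)\<in>H. norm a \<le> sum r I) \<and>
    (\<Union>i\<in>I. bang_strip (G i)) \<subseteq> bang_strip H"
  using assms
proof (induction I rule: finite_induct)
  case empty
  \<comment> \<open>The empty sum of bounds is 0, which forces the slope 0.\<close>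
  show ?case by (rule exI[of _ "{(0, 0)}"]) auto
next
  case (insert i I)
  then obtain H where H: "finite H" "H \<noteq> {}" "\<And>a c. (a, c) \<in> H \<Longrightarrow> norm a \<le> sum r I"
      "(\<Union>i\<in>I. bang_strip (G i)) \<subseteq> bang_strip H"
    by (metis (no_types, lifting) case_prodD insertCI)
  have Gi: "finite (G i)" "G i \<noteq> {}" "\<And>a c. (a, c) \<in> G i \<Longrightarrow> norm a \<le> r i"
    using insert.prems[of i] by auto
  let ?H = "(\<lambda>((a, c), (a', c')). (a + a', c + c')) ` (G i \<times> H)"
  have "(\<Union>i\<in>insert i I. bang_strip (G i)) \<subseteq> bang_strip ?H"
    using bang_strip_sum[of "G i" H] H(4) by auto
  moreover have "norm (a + a') \<le> sum r (insert i I)" if "(a, c) \<in> G i" "(a', c') \<in> H" for a a' c c'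
    using norm_triangle_le[OF add_mono[OF Gi(3) H(3)]] that insert.hyps by auto
  ultimately show ?case
    using Gi H by (intro exI[of _ ?H]) auto
qed

section \<open>Widths of strips and slope bounds for their families\<close>

lemma affine_max_small_slopes:
  assumes F: "finite F" "F \<noteq> {}" and lip: "L-lipschitz_on UNIV (affine_max F)"
  obtains F' where "finite F'" "F' \<noteq> {}" "affine_max F' = affine_max F"
    and "\<And>a b. (a, b) \<in> F' \<Longrightarrow> norm a \<le> L"
proof
  let ?D = "{y. \<not> affine_max F differentiable (at y)}"
  \<comment> \<open>Pieces steeper than \<open>L\<close> are discarded. They may occur in
    \<open>F\<close>, but they never determine the maximum at a point of differentiability.\<close>
  define F' where "F' = {(a, b)\<in>F. norm a \<le> L}"
  have small: "\<exists>a b. (a, b) \<in> F' \<and> affine_max F y = a \<bullet> y + b" if "y \<notin> ?D" for y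
  proof -
    obtain a where a: "dominant_slope F a y"
      using \<open>y \<notin> ?D\<close> differentiable_iff_dominant_slope[OF F] by blast
    then obtain b0 where "(a, b0) \<in> F" unfolding dominant_slope_def by blast
    then obtain b where b: "(a, b) \<in> F" "affine_max F y = a \<bullet> y + b"
      using dominant_slope_affine[OF F] a by metis
    \<comment> \<open>A step from \<open>y\<close> in direction \<open>a\<close> raises the active
      piece by the squared norm of \<open>a\<close>, which the Lipschitz bound limits.\<close>
    have "norm a * norm a \<le> affine_max F (y + a) - affine_max F y"
      using affine_max_ge[OF F b(1), of "y + a"] b(2)
      by (simp add: inner_add_right power2_norm_eq_inner power2_eq_square[symmetric])
    also have "\<dots> \<le> L * norm a"
      using lipschitz_onD[OF lip, of "y + a" y] by (simp add: dist_norm)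
    finally have "norm a \<le> L" using lipschitz_on_nonneg[OF lip] by (cases "a = 0") auto
    then show ?thesis using b F'_def by blast
  qed
  show fin: "finite F'" using F(1) unfolding F'_def by (rule rev_finite_subset) auto
  \<comment> \<open>The null set \<open>?D\<close> misses some point, whose active piece then
    belongs to \<open>F'\<close>.\<close>
  have "?D \<noteq> UNIV"
    using negligible_nondifferentiable[OF F] open_not_negligible[OF open_UNIV] by auto
  then show ne: "F' \<noteq> {}" using small by blast
  show "norm a \<le> L" if "(a, b) \<in> F'" for a b using that F'_def by simp
  have le: "affine_max F' y \<le> affine_max F y" for y
    using affine_max_attained[OF fin ne, of y] affine_max_ge[OF F] unfolding F'_def
    by (metis (no_types, lifting) case_prodD mem_Collect_eq)
  \<comment> \<open>The set of disagreement is null as a subset of \<open>?D\<close> and open by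
    continuity, hence empty.\<close>
  have "{y. affine_max F' y < affine_max F y} \<subseteq> ?D"
    using small affine_max_ge[OF fin ne] by (metis (lifting) mem_Collect_eq not_le subsetI)
  then have "negligible {y. affine_max F' y < affine_max F y}"
    using negligible_nondifferentiable[OF F] negligible_subset by blast
  moreover have "open {y. affine_max F' y < affine_max F y}"
    using continuous_affine_max[OF fin ne] continuous_affine_max[OF F]
    by (intro open_Collect_less)
  ultimately have "{y. affine_max F' y < affine_max F y} = {}"
    using open_not_negligible by blast
  then have "affine_max F y \<le> affine_max F' y" for y by (auto simp: not_less)
  then show "affine_max F' = affine_max F" using le by (intro ext antisym)
qed

lemma Lip_nonneg:
  assumes "polyhedral_fun f"
  shows "0 \<le> Lip f"
proof -
  obtain F where F: "finite F" "F \<noteq> {}" "f = affine_max F"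
    using assms polyhedral_fun_iff by blast
  obtain L where "\<And>a b. (a, b) \<in> F \<Longrightarrow> norm a \<le> L"
    using slopes_bounded[OF F(1,2)] by blast
  then have "L-lipschitz_on UNIV f" using affine_max_lipschitz[OF F(1,2)] F(3) by blast
  then show ?thesis
    unfolding Lip_def by (intro cInf_greatest) (auto dest: lipschitz_on_nonneg)
qed

lemma strip_width_nonneg:
  assumes "generalized_strip S"
  shows "0 \<le> strip_width S"
proof -
  have "0 \<le> Inf {Lip f |f. polyhedral_fun f \<and> S = strip_of f}"
  proof (rule cInf_greatest)
    show "{Lip f |f. polyhedral_fun f \<and> S = strip_of f} \<noteq> {}"
      using assms unfolding generalized_strip_def by blast
    show "0 \<le> l" if "l \<in> {Lip f |f. polyhedral_fun f \<and> S = strip_of f}" for l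
      using that Lip_nonneg by blast
  qed
  then show ?thesis unfolding strip_width_def by simp
qed

text \<open>Both the width and \<open>Lip\<close> are infima, so the strict bound leaves room to
  choose first a function and then a Lipschitz constant; that constant bounds the slopes once the
  steep pieces are dropped.\<close>

lemma generalized_strip_small_slopes:
  assumes S: "generalized_strip S" and w: "strip_width S < w"
  obtains G where "finite G" "G \<noteq> {}" "S = bang_strip G"
    and "\<And>a c. (a, c) \<in> G \<Longrightarrow> norm a \<le> w / 2"
proof -
  have "Inf {Lip f |f. polyhedral_fun f \<and> S = strip_of f} < w / 2"
    using w unfolding strip_width_def by simp
  moreover have "{Lip f |f. polyhedral_fun f \<and> S = strip_of f} \<noteq> {}"
    using S unfolding generalized_strip_def by blast
  ultimately obtain l where "l \<in> {Lip f |f. polyhedral_fun f \<and> S = strip_of f}" "l < w / 2"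
    using cInf_lessD by meson
  then obtain f where f: "polyhedral_fun f" "S = strip_of f" "Lip f < w / 2" by blast
  obtain F where F: "finite F" "F \<noteq> {}" "f = affine_max F"
    using f(1) polyhedral_fun_iff by blast
  obtain L0 where "\<And>a b. (a, b) \<in> F \<Longrightarrow> norm a \<le> L0"
    using slopes_bounded[OF F(1,2)] by blast
  then have "{L. L-lipschitz_on UNIV f} \<noteq> {}"
    using affine_max_lipschitz[OF F(1,2)] F(3) by blast
  then obtain L where "L \<in> {L. L-lipschitz_on UNIV f}" "L < w / 2"
    using cInf_lessD f(3) unfolding Lip_def by meson
  then have L: "L-lipschitz_on UNIV f" "L < w / 2" by auto
  obtain F' where F': "finite F'" "F' \<noteq> {}" "affine_max F' = f"
      "\<And>a b. (a, b) \<in> F' \<Longrightarrow> norm a \<le> L"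
    using affine_max_small_slopes[OF F(1,2) L(1)[unfolded F(3)]] unfolding F(3) by blast
  obtain G where G: "bang_lift G = F'" by (rule bang_lift_surj)
  have "inj_on (\<lambda>(a, c). (a, c + (norm a)\<^sup>2 / 2)) G" by (auto simp: inj_on_def)
  then have finG: "finite G"
    using F'(1) unfolding G[symmetric] bang_lift_def by (simp add: finite_image_iff)
  moreover have neG: "G \<noteq> {}" using F'(2) G unfolding bang_lift_def by auto
  moreover have "S = bang_strip G"
    using strip_of_bang_lift[OF finG neG] G F'(3) f(2) by simp
  moreover have "norm a \<le> w / 2" if "(a, c) \<in> G" for a c
  proof -
    have "(a, c + (norm a)\<^sup>2 / 2) \<in> F'"
      using that unfolding G[symmetric] bang_lift_def by (auto intro: rev_image_eqI)
    then show ?thesis using F'(4) L(2) by fastforce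
  qed
  ultimately show ?thesis using that by blast
qed

lemma compact_gamma_zero_covered:
  assumes K: "compact K" and gamma: "strip_gamma K = 0" and "\<epsilon> > 0"
  obtains F where "finite F" "F \<noteq> {}" "\<And>a b. (a, b) \<in> F \<Longrightarrow> norm a \<le> \<epsilon>"
    and "K \<subseteq> strip_of (affine_max F)"
proof -
  have "strip_gamma K < ennreal (\<epsilon> / 2)" using gamma \<open>\<epsilon> > 0\<close> by simp
  then obtain S where S: "\<And>i. generalized_strip (S i)" "K \<subseteq> (\<Union>i. S i)"
      "(\<Sum>i::nat. ennreal (strip_width (S i))) < ennreal (\<epsilon> / 2)"
    unfolding strip_gamma_def INF_less_iff by blast
  \<comment> \<open>The widths will use at most half of \<epsilon> and the geometric slack the other
    half. The slack supplies the strict bound for choosing \<open>G i\<close>, with slopes at most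
    \<open>w i / 2\<close>, which doubling turns into \<open>w i\<close>.\<close>
  define w where "w i = strip_width (S i) + \<epsilon> / 2 * (1 / 2) ^ Suc i" for i
  have "\<exists>G. finite G \<and> G \<noteq> {} \<and> S i = bang_strip G \<and> (\<forall>(a, c)\<in>G. norm a \<le> w i / 2)" for i
  proof -
    have "strip_width (S i) < w i" unfolding w_def using \<open>\<epsilon> > 0\<close> by simp
    then show ?thesis
      by (rule generalized_strip_small_slopes[OF S(1)]) blast
  qed
  then obtain G where G: "\<And>i. finite (G i) \<and> G i \<noteq> {} \<and> S i = bang_strip (G i) \<and>
      (\<forall>(a, c)\<in>G i. norm a \<le> w i / 2)" by metis
  define H where "H i = (\<lambda>(a, c). (2 *\<^sub>R a, 2 * c)) ` G i" for i
  have "S i \<subseteq> interior (bang_strip (H i))" for i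
    using bang_strip_subset_interior_double G unfolding H_def by metis
  then have "(\<Union>i. S i) \<subseteq> (\<Union>i. interior (bang_strip (H i)))" by (intro UN_mono) auto
  with S(2) have "K \<subseteq> (\<Union>i. interior (bang_strip (H i)))" by (rule order_trans)
  then obtain I where I: "finite I" "K \<subseteq> (\<Union>i\<in>I. interior (bang_strip (H i)))"
    by (rule compactE_image[OF K open_interior])
  have "finite (H i) \<and> H i \<noteq> {} \<and> (\<forall>(a, c)\<in>H i. norm a \<le> w i)" for i
    using G[of i] unfolding H_def by auto
  from bang_strip_finite_union[OF I(1), of H w, OF this]
  obtain M where M: "finite M" "M \<noteq> {}" "\<And>a c. (a, c) \<in> M \<Longrightarrow> norm a \<le> sum w I"
      "(\<Union>i\<in>I. bang_strip (H i)) \<subseteq> bang_strip M"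
    by auto
  have "ennreal (\<Sum>i\<in>I. strip_width (S i)) = (\<Sum>i\<in>I. ennreal (strip_width (S i)))"
    using strip_width_nonneg[OF S(1)] by simp
  also have "\<dots> \<le> (\<Sum>i. ennreal (strip_width (S i)))"
    using I(1) by (intro sum_le_suminf) auto
  also have "\<dots> < ennreal (\<epsilon> / 2)" by (rule S(3))
  finally have "(\<Sum>i\<in>I. strip_width (S i)) \<le> \<epsilon> / 2"
    using \<open>\<epsilon> > 0\<close> by (simp add: ennreal_less_iff sum_nonneg strip_width_nonneg[OF S(1)])
  moreover have "(\<Sum>i\<in>I. (1 / 2) ^ Suc i) \<le> (1::real)"
    using sum_le_suminf[OF sums_summable[OF power_half_series] I(1)]
      sums_unique[OF power_half_series] by simp
  ultimately have "sum w I \<le> \<epsilon> / 2 + \<epsilon> / 2 * 1"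
    unfolding w_def sum.distrib sum_distrib_left[symmetric]
    using \<open>\<epsilon> > 0\<close> by (intro add_mono mult_left_mono) auto
  then have slopes: "norm a \<le> \<epsilon>" if "(a, c) \<in> M" for a c
    using M(3)[OF that] by simp
  show ?thesis
  proof
    show "finite (bang_lift M)" "bang_lift M \<noteq> {}" using M(1,2) unfolding bang_lift_def by auto
    show "norm a \<le> \<epsilon>" if "(a, b) \<in> bang_lift M" for a b
      using that slopes unfolding bang_lift_def by auto
    have "(\<Union>i\<in>I. interior (bang_strip (H i))) \<subseteq> (\<Union>i\<in>I. bang_strip (H i))"
      by (intro UN_mono interior_subset subset_refl)
    then show "K \<subseteq> strip_of (affine_max (bang_lift M))"
      using I(2) M(4) unfolding strip_of_bang_lift[OF M(1,2)] by order
  qed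
qed

section \<open>Images under the proximal map\<close>

text \<open>Over a point \<open>y\<close> of differentiability, \<open>y + a\<close> lies off the
  strip and so off the frontier of \<open>A\<close>. A ball around it is inside or outside
  \<open>A\<close>, and the local translation carries this over to the image near
  \<open>y\<close>.\<close>

lemma frontier_prox_image:
  assumes F: "finite F" "F \<noteq> {}" and A: "frontier A \<subseteq> strip_of (affine_max F)"
  shows "frontier (prox (affine_max F) ` A) \<subseteq> {y. \<not> affine_max F differentiable (at y)}"
proof
  let ?g = "prox (affine_max F)"
  fix y assume y: "y \<in> frontier (?g ` A)"
  show "y \<in> {y. \<not> affine_max F differentiable (at y)}"
  proof (rule ccontr)
    assume "y \<notin> {y. \<not> affine_max F differentiable (at y)}"
    then obtain a where a: "dominant_slope F a y"
      using differentiable_iff_dominant_slope[OF F] by blast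
    then obtain e where e: "e > 0" "\<And>y'. y' \<in> ball y e \<Longrightarrow> dominant_slope F a y'"
      using dominant_slope_open[OF F] by blast
    have "y + a \<notin> strip_of (affine_max F)"
      using not_in_strip_of_iff[OF F] a by (metis add_diff_cancel_right')
    then have "y + a \<notin> frontier A" using A by blast
    then consider "y + a \<in> interior A" | "y + a \<in> interior (- A)"
      unfolding frontier_def interior_complement by blast
    then obtain d where d: "d > 0" "ball (y + a) d \<subseteq> A \<or> ball (y + a) d \<subseteq> - A"
      unfolding mem_interior by blast
    have shift: "y' + a \<in> ball (y + a) d" if "y' \<in> ball y (min e d)" for y'
      using that by (simp add: dist_norm)
    have image_iff: "y' \<in> ?g ` A \<longleftrightarrow> y' + a \<in> A" if "y' \<in> ball y (min e d)" for y'
    proof -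
      have "dominant_slope F a y'" using e(2) that by simp
      then have "?g x = y' \<longleftrightarrow> x = y' + a" for x by (rule prox_eq_iff_dominant_slope[OF F])
      then show ?thesis by (metis imageE imageI)
    qed
    from d(2) show False
    proof
      assume "ball (y + a) d \<subseteq> A"
      then have "ball y (min e d) \<subseteq> ?g ` A" using shift image_iff by blast
      moreover have "min e d > 0" using e(1) d(1) by simp
      ultimately have "y \<in> interior (?g ` A)" unfolding mem_interior by blast
      then show False using y unfolding frontier_def by simp
    next
      assume "ball (y + a) d \<subseteq> - A"
      then have "ball y (min e d) \<subseteq> - ?g ` A" using shift image_iff by blast
      moreover have "min e d > 0" using e(1) d(1) by simp
      ultimately have "y \<in> interior (- ?g ` A)" unfolding mem_interior by blast
      then show False using y unfolding frontier_def interior_complement by simp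
    qed
  qed
qed

lemma polyhedral_set_prox_image:
  assumes F: "finite F" "F \<noteq> {}" and A: "frontier A \<subseteq> strip_of (affine_max F)"
  shows "polyhedral_set (prox (affine_max F) ` A)"
proof -
  obtain \<H> where H: "finite \<H>" "\<forall>H\<in>\<H>. \<exists>a b. a \<noteq> 0 \<and> H = {x::'a. a \<bullet> x = b}"
    "{y. \<not> affine_max F differentiable (at y)} \<subseteq> \<Union>\<H>"
    by (rule nondifferentiable_in_hyperplanes[OF F])
  have "frontier (prox (affine_max F) ` A) \<subseteq> \<Union>\<H>"
    using frontier_prox_image[OF F A] H(3) by (rule order_trans)
  with H(1,2) show ?thesis unfolding polyhedral_set_def by blast
qed

lemma prox_covers:
  assumes F: "finite F" "F \<noteq> {}" and slopes: "\<And>a b. (a, b) \<in> F \<Longrightarrow> norm a \<le> L"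
    and y: "cball y L \<subseteq> A" "affine_max F differentiable (at y)"
  shows "y \<in> prox (affine_max F) ` A"
proof -
  obtain a where a: "dominant_slope F a y"
    using y(2) differentiable_iff_dominant_slope[OF F] by blast
  then have "norm a \<le> L" using slopes unfolding dominant_slope_def by blast
  then have "y + a \<in> A" using y(1) by (auto simp: dist_norm)
  moreover have "prox (affine_max F) (y + a) = y"
    using prox_eq_iff_dominant_slope[OF F a] by simp
  ultimately show ?thesis by (metis imageI)
qed

text \<open>Up to a null set, \<open>D\<close> splits into the regions \<open>U a\<close>. Their
  translates by \<open>a\<close> are pairwise disjoint, stay in \<open>B\<close> and avoid the
  strip, so they fit into \<open>B - K\<close>.\<close>

lemma measure_outside_strip_ge:
  assumes F: "finite F" "F \<noteq> {}" and slopes: "\<And>a b. (a, b) \<in> F \<Longrightarrow> norm a \<le> L"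
    and D: "D \<in> lmeasurable" and B: "B \<in> lmeasurable" and DB: "\<And>y. y \<in> D \<Longrightarrow> cball y L \<subseteq> B"
    and K: "K \<in> lmeasurable" "K \<subseteq> B" "K \<subseteq> strip_of (affine_max F)"
  shows "measure lebesgue D \<le> measure lebesgue B - measure lebesgue K"
proof -
  let ?N = "{y. \<not> affine_max F differentiable (at y)}"
  define U where "U a = D \<inter> {y. dominant_slope F a y}" for a
  have "open {y. dominant_slope F a y}" for a
    unfolding open_contains_ball using dominant_slope_open[OF F] by (metis mem_Collect_eq subsetI)
  then have U: "U a \<in> lmeasurable" for a
    unfolding U_def using D by (intro fmeasurable_Int_fmeasurable) auto
  have "D - (\<Union>a\<in>fst ` F. U a) \<subseteq> ?N"
  proof
    fix y assume y: "y \<in> D - (\<Union>a\<in>fst ` F. U a)"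
    have "\<not> dominant_slope F a y" for a
    proof
      assume a: "dominant_slope F a y"
      then have "a \<in> fst ` F" unfolding dominant_slope_def by force
      then show False using y a unfolding U_def by blast
    qed
    then show "y \<in> ?N" using differentiable_iff_dominant_slope[OF F] by blast
  qed
  then have "negligible (D - (\<Union>a\<in>fst ` F. U a))"
    using negligible_nondifferentiable[OF F] negligible_subset by blast
  moreover have "(\<Union>a\<in>fst ` F. U a) - D = {}" unfolding U_def by blast
  ultimately have "negligible (D - (\<Union>a\<in>fst ` F. U a) \<union> ((\<Union>a\<in>fst ` F. U a) - D))"
    by (simp only: Un_empty_right)
  then have "measure lebesgue D = measure lebesgue (\<Union>a\<in>fst ` F. U a)"
    by (rule measure_negligible_symdiff[OF D, symmetric])
  also have "\<dots> \<le> (\<Sum>a\<in>fst ` F. measure lebesgue (U a))"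
    using F(1) U by (intro measure_UNION_le) auto
  also have "\<dots> = (\<Sum>a\<in>fst ` F. measure lebesgue ((+) a ` U a))"
    by (simp add: measure_translation)
  also have "\<dots> = measure lebesgue (\<Union>a\<in>fst ` F. (+) a ` U a)"
  proof (rule measure_UNION'[symmetric])
    show "finite (fst ` F)" using F(1) by simp
    show "(+) a ` U a \<in> lmeasurable" for a using U by (rule measurable_translation)
    show "pairwise (\<lambda>a a'. disjnt ((+) a ` U a) ((+) a' ` U a')) (fst ` F)"
    proof (rule pairwiseI)
      fix a a' :: 'a assume "a \<noteq> a'"
      \<comment> \<open>The proximal map undoes every one of these translations, so a common point
        of two translates determines \<open>y\<close> and then the slope.\<close>
      have prox: "prox (affine_max F) (a + y) = y" if "y \<in> U a" for a y
        using that prox_eq_iff_dominant_slope[OF F, of a y "a + y"] unfolding U_def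
        by (simp add: add.commute)
      have "a = a'" if "y \<in> U a" "y' \<in> U a'" "a + y = a' + y'" for y y'
      proof -
        have "y = y'" using prox[OF that(1)] prox[OF that(2)] that(3) by simp
        then show ?thesis using that(3) by simp
      qed
      then show "disjnt ((+) a ` U a) ((+) a' ` U a')"
        using \<open>a \<noteq> a'\<close> unfolding disjnt_iff by blast
    qed
  qed
  also have "\<dots> \<le> measure lebesgue (B - K)"
  proof (rule measure_mono_fmeasurable)
    show "(\<Union>a\<in>fst ` F. (+) a ` U a) \<in> sets lebesgue"
      using F(1) measurable_translation[OF U] by (intro sets.finite_UN) auto
    show "B - K \<in> lmeasurable" using B K(1) by (intro fmeasurable.Diff)
    show "(\<Union>a\<in>fst ` F. (+) a ` U a) \<subseteq> B - K"
    proof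
      fix x assume "x \<in> (\<Union>a\<in>fst ` F. (+) a ` U a)"
      then obtain a b y where "(a, b) \<in> F" "y \<in> U a" and x: "x = a + y" by auto
      then have y: "y \<in> D" "dominant_slope F a y" "norm a \<le> L" using slopes unfolding U_def by auto
      have "x \<in> cball y L" using x y(3) by (simp add: dist_norm)
      then have "x \<in> B" using DB y(1) by blast
      moreover have "x \<notin> strip_of (affine_max F)"
        unfolding not_in_strip_of_iff[OF F] using x y(2) by (intro exI[of _ a]) simp
      ultimately show "x \<in> B - K" using K(3) by blast
    qed
  qed
  also have "\<dots> = measure lebesgue B - measure lebesgue K"
    using B K by (intro measurable_measure_Diff) auto
  finally show ?thesis .
qed

text \<open>Concentric balls of radii \<open>R - \<epsilon>\<close> and \<open>R\<close> bound the
  measure of \<open>K\<close> by the volume of a shell, which vanishes as \<epsilon> tends to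
  0.\<close>

lemma compact_gamma_zero_negligible:
  fixes K :: "'a::euclidean_space set"
  assumes K: "compact K" and gamma: "strip_gamma K = 0"
  shows "negligible K"
proof -
  obtain R where R: "R > 0" "K \<subseteq> cball 0 R"
    using compact_imp_bounded[OF K] unfolding bounded_pos by (auto simp: subset_iff)
  have Km: "K \<in> lmeasurable" using K by (rule lmeasurable_compact)
  let ?v = "\<lambda>r. unit_ball_vol (DIM('a)) * r ^ DIM('a)"
  have vol: "measure lebesgue (cball (0::'a) r) = ?v r" if "r \<ge> 0" for r
    using content_cball[OF that, of "0::'a"] by simp
  have "measure lebesgue K \<le> ?v R - ?v (R - \<epsilon>)" if \<epsilon>: "\<epsilon> > 0" "\<epsilon> < R" for \<epsilon>
  proof -
    obtain F where F: "finite F" "F \<noteq> {}" "\<And>a b. (a, b) \<in> F \<Longrightarrow> norm a \<le> \<epsilon>"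
        "K \<subseteq> strip_of (affine_max F)"
      using compact_gamma_zero_covered[OF K gamma \<epsilon>(1)] by blast
    have "measure lebesgue (cball (0::'a) (R - \<epsilon>)) \<le> measure lebesgue (cball (0::'a) R) - measure lebesgue K"
    proof (rule measure_outside_strip_ge[OF F(1,2,3) _ _ _ Km R(2) F(4)])
      show "cball y \<epsilon> \<subseteq> cball 0 R" if "y \<in> cball 0 (R - \<epsilon>)" for y :: 'a
        using that by (simp add: cball_subset_cball_iff dist_norm)
    qed auto
    then show ?thesis using vol[of R] vol[of "R - \<epsilon>"] \<epsilon> R(1) by simp
  qed
  then have "\<forall>\<^sub>F \<epsilon> in at_right 0. measure lebesgue K \<le> ?v R - ?v (R - \<epsilon>)"
    using R(1) by (intro eventually_at_rightI[of 0 R]) auto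
  moreover have "((\<lambda>\<epsilon>. ?v R - ?v (R - \<epsilon>)) \<longlongrightarrow> ?v R - ?v (R - 0)) (at_right 0)"
    by (intro tendsto_intros)
  ultimately have "measure lebesgue K \<le> ?v R - ?v (R - 0)"
    by (intro tendsto_lowerbound) auto
  then show ?thesis
    using negligible_iff_measure0[OF Km] measure_nonneg[of lebesgue K] by simp
qed

theorem theorem1p9:
  fixes A :: "(real ^ 'n) set"
  assumes "bounded A"
    and "strip_gamma (frontier A) = 0"
  shows "distance_kolmogorov A \<and> measure_kolmogorov A"
proof
  have K: "compact (frontier A)" using assms(1) by (rule compact_frontier_bounded)
  note cover = compact_gamma_zero_covered[OF K assms(2)]
  show "distance_kolmogorov A"
    unfolding distance_kolmogorov_def
  proof (intro conjI allI impI assms(1))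
    fix \<epsilon> :: real assume "\<epsilon> > 0"
    then obtain F where F: "finite F" "F \<noteq> {}" "\<And>a b. (a, b) \<in> F \<Longrightarrow> norm a \<le> \<epsilon>"
        "frontier A \<subseteq> strip_of (affine_max F)"
      using cover by blast
    show "\<exists>f. 1-lipschitz_on A f \<and> polyhedral_set (f ` A) \<and> (\<forall>x\<in>A. norm (f x - x) \<le> \<epsilon>)"
    proof (intro exI conjI ballI)
      show "1-lipschitz_on A (prox (affine_max F))"
        using prox_lipschitz[OF F(1,2)] subset_UNIV by (rule lipschitz_on_subset)
      show "polyhedral_set (prox (affine_max F) ` A)"
        using F(1,2,4) by (rule polyhedral_set_prox_image)
      show "norm (prox (affine_max F) x - x) \<le> \<epsilon>" for x
        using F by (intro prox_dist)
    qed
  qed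
  have neg: "negligible (frontier A)"
    using K assms(2) by (rule compact_gamma_zero_negligible)
  \<comment> \<open>Measurability of \<open>A\<close> is not assumed; it follows from boundedness
    and the null frontier.\<close>
  have A: "A \<in> lmeasurable" using assms(1) neg by (rule measurable_Jordan)
  show "measure_kolmogorov A"
    unfolding measure_kolmogorov_def
  proof (intro conjI allI impI assms(1))
    show "A \<in> sets lebesgue" using A by simp
    fix \<epsilon> :: real assume "\<epsilon> > 0"
    have int: "interior A \<in> lmeasurable" using assms(1) by (simp add: lmeasurable_interior)
    have int_eq: "measure lebesgue (interior A) = measure lebesgue A"
      using assms(1) neg by (rule measure_interior)
    \<comment> \<open>\<open>C\<close> exhausts \<open>interior A\<close> up to measure \<epsilon>.
      Being compact, it keeps a positive distance \<open>e\<close> from the complement.\<close>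
    obtain C where C: "closed C" "C \<subseteq> interior A" "interior A - C \<in> lmeasurable"
        "emeasure lebesgue (interior A - C) < ennreal \<epsilon>"
      using sets_lebesgue_inner_closed[OF fmeasurableD[OF int] \<open>\<epsilon> > 0\<close>] by blast
    have "compact C"
      using C(1,2) assms(1) bounded_subset interior_subset
      by (metis compact_eq_bounded_closed)
    then have Cm: "C \<in> lmeasurable" by (rule lmeasurable_compact)
    have "measure lebesgue (interior A - C) < \<epsilon>"
      using C(3,4) \<open>\<epsilon> > 0\<close> by (simp add: emeasure_eq_measure2 ennreal_less_iff)
    then have C_large: "measure lebesgue A - \<epsilon> < measure lebesgue C"
      using measurable_measure_Diff[OF int _ C(2)] Cm int_eq by simp
    obtain e where e: "e > 0" "(\<Union>x\<in>C. ball x e) \<subseteq> interior A"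
      using compact_subset_open_imp_ball_epsilon_subset[OF \<open>compact C\<close> open_interior C(2)] .
    \<comment> \<open>With slopes at most \<open>e / 2\<close>, the closed balls that
      \<open>prox_covers\<close> requires fit into the open balls of radius \<open>e\<close> inside
      \<open>A\<close>.\<close>
    obtain F where F: "finite F" "F \<noteq> {}" "\<And>a b. (a, b) \<in> F \<Longrightarrow> norm a \<le> e / 2"
        "frontier A \<subseteq> strip_of (affine_max F)"
      using cover[of "e / 2"] e(1) by auto
    let ?g = "prox (affine_max F)"
    let ?N = "{y. \<not> affine_max F differentiable (at y)}"
    have lip: "1-lipschitz_on A ?g"
      using lipschitz_on_subset[OF prox_lipschitz[OF F(1,2)] subset_UNIV] .
    have N: "negligible ?N" using F(1,2) by (rule negligible_nondifferentiable)
    have "C - ?N \<subseteq> ?g ` A"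
    proof
      fix y assume y: "y \<in> C - ?N"
      have "cball y (e / 2) \<subseteq> ball y e" using e(1) by auto
      also have "\<dots> \<subseteq> A" using e(2) y interior_subset by blast
      finally show "y \<in> ?g ` A" using F(1-3) y by (intro prox_covers[of F "e / 2"]) auto
    qed
    \<comment> \<open>The image is again bounded, and its frontier consists of points of
      nondifferentiability, hence is null.\<close>
    moreover have "?g ` A \<in> lmeasurable"
    proof (rule measurable_Jordan)
      show "bounded (?g ` A)"
        using lip assms(1) by (intro bounded_uniformly_continuous_image lipschitz_on_uniformly_continuous)
      show "negligible (frontier (?g ` A))"
        using N frontier_prox_image[OF F(1,2,4)] by (rule negligible_subset)
    qed
    moreover have "?N \<in> null_sets lebesgue" using N negligible_iff_null_sets by blast
    then have "C - ?N \<in> sets lebesgue" "measure lebesgue (C - ?N) = measure lebesgue C"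
      using Cm by (auto intro: measure_Diff_null_set)
    ultimately have "measure lebesgue C \<le> measure lebesgue (?g ` A)"
      using measure_mono_fmeasurable by metis
    then have "measure lebesgue (?g ` A) > measure lebesgue A - \<epsilon>" using C_large by simp
    then show "\<exists>f :: real ^ 'n \<Rightarrow> real ^ 'n. 1-lipschitz_on A f \<and> polyhedral_set (f ` A) \<and>
        measure lebesgue (f ` A) > measure lebesgue A - \<epsilon>"
      using lip polyhedral_set_prox_image[OF F(1,2,4)] by (intro exI[of _ ?g] conjI)
  qed
qed

end
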